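(* If $\Gamma\vdash_\ell M:A$ is derivable in $\Lambda_\cap^\ell$, then $M$ is weakly $\beta$-normalising.
   Context: $\lambda$-terms: $M::=x\mid MM\mid\lambda x.M$ modulo $\alpha$-conversion; $M[x:=N]$ capture-avoiding substitution; $\beta$-reduction is the contextual closure of $(\lambda x.M)N\to M[x:=N]$; weakly normalising means some reduction sequence reaches a $\beta$-normal form. Types: $A::=\varphi\mid A\to A\mid A\cap A$. A typing context is a finite set of pairs $x:A$, where a variable may occur with several types; $\Gamma,x:A$ denotes $\Gamma\cup\{x:A\}$; $x\notin\Gamma$ means no $x:B$ lies in $\Gamma$. Rules of $\Lambda_\cap^\ell$ ($n\ge0$): (Ax) $\Gamma,x:A\vdash_\ell x:A$; $(\mathsf{Beta})^\ell$ from $\Gamma\vdash_\ell M[x:=N]N_1\dots N_n:A$ infer $\Gamma\vdash_\ell(\lambda x.M)NN_1\dots N_n:A$; $(\mathsf{L}\to)$ from $\Gamma\vdash_\ell N:A_1$ and $\Gamma,y:A_2\vdash_\ell yN_1\dots N_n:B$, with $y\notin FV(N_1)\cup\dots\cup FV(N_n)$, $y\notin\Gamma$, infer $\Gamma,x:A_1\to A_2\vdash_\ell xNN_1\dots N_n:B$; $(\mathsf{R}\to)$ from $\Gamma,x:A\vdash_\ell M:B$, $x\notin\Gamma$, infer $\Gamma\vdash_\ell\lambda x.M:A\to B$; $(\mathsf{L}\cap)$ from $\Gamma,x:A_1,x:A_2\vdash_\ell xN_1\dots N_n:B$ infer $\Gamma,x:A_1\cap A_2\vdash_\ell xN_1\dots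 N_n:B$; $(\mathsf{R}\cap)$ from $\Gamma\vdash_\ell M:A$ and $\Gamma\vdash_\ell M:B$ infer $\Gamma\vdash_\ell M:A\cap B$. *)

theory Defs
  imports Main "HOL-Library.FSet"
begin

text \<open>Lambda terms modulo alpha-conversion are represented with de Bruijn indices: under
  \<open>k\<close> binders, the index \<open>k + i\<close> denotes the \<open>i\<close>-th free variable.\<close>

datatype trm = Var nat | App trm trm | Lam trm

definition apps :: "trm \<Rightarrow> trm list \<Rightarrow> trm" where
  "apps M Ns = foldl App M Ns"

fun lift :: "nat \<Rightarrow> trm \<Rightarrow> trm" where
  "lift k (Var i) = Var (if i < k then i else Suc i)"
| "lift k (App M N) = App (lift k M) (lift k N)"
| "lift k (Lam M) = Lam (lift (Suc k) M)"

text \<open>\<open>subst k N M\<close> replaces index \<open>k\<close> by \<open>N\<close> and removes \<open>k\<close> from the scope,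
  so that the contractum of \<open>App (Lam M) N\<close> is \<open>subst 0 N M\<close>.\<close>

fun subst :: "nat \<Rightarrow> trm \<Rightarrow> trm \<Rightarrow> trm" where
  "subst k N (Var i) = (if i < k then Var i else if i = k then N else Var (i - 1))"
| "subst k N (App M P) = App (subst k N M) (subst k N P)"
| "subst k N (Lam M) = Lam (subst (Suc k) (lift 0 N) M)"

fun FV :: "trm \<Rightarrow> nat set" where
  "FV (Var i) = {i}"
| "FV (App M N) = FV M \<union> FV N"
| "FV (Lam M) = {i. Suc i \<in> FV M}"

inductive beta :: "trm \<Rightarrow> trm \<Rightarrow> bool" where
  contract: "beta (App (Lam M) N) (subst 0 N M)"
| appL: "beta M M' \<Longrightarrow> beta (App M N) (App M' N)"
| appR: "beta N N' \<Longrightarrow> beta (App M N) (App M N')"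
| lam: "beta M M' \<Longrightarrow> beta (Lam M) (Lam M')"

definition normal :: "trm \<Rightarrow> bool" where
  "normal M \<longleftrightarrow> (\<nexists>N. beta M N)"

definition weakly_normalising :: "trm \<Rightarrow> bool" where
  "weakly_normalising M \<longleftrightarrow> (\<exists>N. beta\<^sup>*\<^sup>* M N \<and> normal N)"

text \<open>The type parameter \<open>'a\<close> is the set of atomic types.\<close>

datatype 'a ty = Atom 'a | Arrow "'a ty" "'a ty" | Inter "'a ty" "'a ty"

type_synonym 'a ctx = "(nat \<times> 'a ty) fset"

definition not_in_ctx :: "nat \<Rightarrow> 'a ctx \<Rightarrow> bool" where
  "not_in_ctx x \<Gamma> \<longleftrightarrow> (\<forall>B. (x, B) |\<notin>| \<Gamma>)"

text \<open>Entering a binder shifts the variables of the context, which leaves index \<open>0\<close> fresh for it.\<close>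

definition lift_ctx :: "'a ctx \<Rightarrow> 'a ctx" where
  "lift_ctx \<Gamma> = (\<lambda>(x, B). (Suc x, B)) |`| \<Gamma>"

lemma not_in_lift_ctx: "not_in_ctx 0 (lift_ctx \<Gamma>)"
  by (auto simp: not_in_ctx_def lift_ctx_def)

text \<open>The lists \<open>Ns\<close> may be empty.  The side condition \<open>x \<notin> \<Gamma>\<close> of the named version of \<open>R_arrow\<close>
  holds by \<open>not_in_lift_ctx\<close>.\<close>

inductive typing :: "'a ctx \<Rightarrow> trm \<Rightarrow> 'a ty \<Rightarrow> bool" where
  Ax: "typing (finsert (x, A) \<Gamma>) (Var x) A"
| Beta: "typing \<Gamma> (apps (subst 0 N M) Ns) A \<Longrightarrow> typing \<Gamma> (apps (App (Lam M) N) Ns) A"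
| L_arrow: "\<lbrakk>typing \<Gamma> N A1; typing (finsert (y, A2) \<Gamma>) (apps (Var y) Ns) B;
    \<forall>P\<in>set Ns. y \<notin> FV P; not_in_ctx y \<Gamma>\<rbrakk>
    \<Longrightarrow> typing (finsert (x, Arrow A1 A2) \<Gamma>) (apps (App (Var x) N) Ns) B"
| R_arrow: "typing (finsert (0, A) (lift_ctx \<Gamma>)) M B \<Longrightarrow> typing \<Gamma> (Lam M) (Arrow A B)"
| L_inter: "typing (finsert (x, A1) (finsert (x, A2) \<Gamma>)) (apps (Var x) Ns) B
    \<Longrightarrow> typing (finsert (x, Inter A1 A2) \<Gamma>) (apps (Var x) Ns) B"
| R_inter: "\<lbrakk>typing \<Gamma> M A; typing \<Gamma> M B\<rbrakk> \<Longrightarrow> typing \<Gamma> M (Inter A B)"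

end

theory Submission imports Defs begin

text \<open>There is no cut rule, so a normal form can be built by induction on the derivation: rule
  \<open>Beta\<close> is a single head expansion, and the only case with content is \<open>L_arrow\<close>. There, a term
  with a variable at its head reduces only inside its arguments, hence it is weakly normalising
  if and only if all its arguments are, whatever the head variable is.\<close>

lemma apps_Nil [simp]: "apps M [] = M"
  and apps_Cons [simp]: "apps M (N # Ns) = apps (App M N) Ns"
  and apps_snoc [simp]: "apps M (Ns @ [N]) = App (apps M Ns) N"
  by (simp_all add: apps_def)

text \<open>A spine over a variable is a variable or an application. Hence applying it to a further
  argument creates no redex at the root.\<close>

lemma apps_Var_neq_Lam: "apps (Var x) Ns \<noteq> Lam M"
  by (cases Ns rule: rev_cases) auto

inductive_cases beta_VarE: "beta (Var x) M"
inductive_cases beta_AppE: "beta (App M N) P"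
inductive_cases beta_LamE: "beta (Lam M) P"

lemma beta_apps_head: "beta M M' \<Longrightarrow> beta (apps M Ns) (apps M' Ns)"
  by (induction Ns rule: rev_induct) (auto intro: beta.appL)

lemma rtranclp_beta_AppI:
  assumes "beta\<^sup>*\<^sup>* M M'" and "beta\<^sup>*\<^sup>* N N'"
  shows "beta\<^sup>*\<^sup>* (App M N) (App M' N')"
proof -
  have "beta\<^sup>*\<^sup>* (App M N) (App M' N)"
    using assms(1) by induction (auto intro: beta.appL rtranclp.rtrancl_into_rtrancl)
  also have "beta\<^sup>*\<^sup>* (App M' N) (App M' N')"
    using assms(2) by induction (auto intro: beta.appR rtranclp.rtrancl_into_rtrancl)
  finally show ?thesis .
qed

lemma rtranclp_beta_LamI: "beta\<^sup>*\<^sup>* M M' \<Longrightarrow> beta\<^sup>*\<^sup>* (Lam M) (Lam M')"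
  by (induction rule: rtranclp_induct) (auto intro: beta.lam rtranclp.rtrancl_into_rtrancl)

lemma normal_Var: "normal (Var x)"
  by (auto simp: normal_def elim: beta_VarE)

lemma normal_Lam: "normal M \<Longrightarrow> normal (Lam M)"
  by (auto simp: normal_def elim: beta_LamE)

lemma normal_App_apps_Var:
  "normal (App (apps (Var x) Ns) N) \<longleftrightarrow> normal (apps (Var x) Ns) \<and> normal N"
  unfolding normal_def
  by (auto intro: beta.appL beta.appR elim!: beta_AppE dest: sym simp: apps_Var_neq_Lam)

text \<open>With \<open>contract\<close> excluded at every application along the spine, a step can
  only act inside an argument, so the head variable survives.\<close>

lemma beta_apps_Var:
  assumes "beta (apps (Var x) Ns) P"
  shows "\<exists>Ns'. P = apps (Var x) Ns'"
  using assms
proof (induction Ns arbitrary: P rule: rev_induct)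
  case Nil
  then show ?case by (auto elim: beta_VarE)
next
  case (snoc N Ns)
  then have "beta (App (apps (Var x) Ns) N) P" by simp
  then show ?case
  proof (cases rule: beta.cases)
    case (contract M)
    then show ?thesis by (simp add: apps_Var_neq_Lam)
  next
    case (appL M')
    then show ?thesis by (metis snoc.IH apps_snoc)
  next
    case (appR N')
    then show ?thesis by (metis apps_snoc)
  qed
qed

text \<open>Each step acts on exactly one side of the application, and the left side remains a spine
  over \<open>x\<close>. The sequence therefore projects to separate reductions of the two
  sides.\<close>

lemma rtranclp_beta_App_apps_Var:
  assumes "beta\<^sup>*\<^sup>* (App (apps (Var x) Ns) N) P"
  shows "\<exists>Ns' N'. P = App (apps (Var x) Ns') N' \<and>
    beta\<^sup>*\<^sup>* (apps (Var x) Ns) (apps (Var x) Ns') \<and> beta\<^sup>*\<^sup>* N N'"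
  using assms
proof induction
  case base
  then show ?case by blast
next
  case (step P Q)
  then obtain Ns' N' where P: "P = App (apps (Var x) Ns') N'"
    and red: "beta\<^sup>*\<^sup>* (apps (Var x) Ns) (apps (Var x) Ns')" "beta\<^sup>*\<^sup>* N N'"
    by blast
  from \<open>beta P Q\<close> have "beta (App (apps (Var x) Ns') N') Q" by (simp add: P)
  then show ?case
  proof (cases rule: beta.cases)
    case (contract M)
    then show ?thesis by (simp add: apps_Var_neq_Lam)
  next
    case (appL M')
    then show ?thesis
      using red by (metis beta_apps_Var rtranclp.rtrancl_into_rtrancl)
  next
    case (appR N'')
    then show ?thesis
      using red by (metis rtranclp.rtrancl_into_rtrancl)
  qed
qed

lemma weakly_normalising_App_apps_Var:
  "weakly_normalising (App (apps (Var x) Ns) N) \<longleftrightarrow>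
    weakly_normalising (apps (Var x) Ns) \<and> weakly_normalising N"
proof
  assume "weakly_normalising (App (apps (Var x) Ns) N)"
  then show "weakly_normalising (apps (Var x) Ns) \<and> weakly_normalising N"
    unfolding weakly_normalising_def
    by (metis rtranclp_beta_App_apps_Var normal_App_apps_Var)
next
  assume *: "weakly_normalising (apps (Var x) Ns) \<and> weakly_normalising N"
  then obtain P N' where red: "beta\<^sup>*\<^sup>* (apps (Var x) Ns) P" "beta\<^sup>*\<^sup>* N N'"
    and nf: "normal P" "normal N'"
    unfolding weakly_normalising_def by blast
  \<comment> \<open>Normality of \<open>P\<close> and \<open>N'\<close> alone would not suffice, as
    \<open>P\<close> could be an abstraction; that it is still a spine over \<open>x\<close> rules
    this out.\<close>
  from red(1) have "\<exists>Ns'. P = apps (Var x) Ns'"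
    by induction (auto dest: beta_apps_Var)
  with nf have "normal (App P N')" by (auto simp: normal_App_apps_Var)
  with red show "weakly_normalising (App (apps (Var x) Ns) N)"
    unfolding weakly_normalising_def by (blast intro: rtranclp_beta_AppI)
qed

lemma weakly_normalising_Var: "weakly_normalising (Var x)"
  unfolding weakly_normalising_def using normal_Var by blast

lemma weakly_normalising_Lam: "weakly_normalising M \<Longrightarrow> weakly_normalising (Lam M)"
  unfolding weakly_normalising_def by (blast intro: rtranclp_beta_LamI normal_Lam)

lemma weakly_normalising_beta_expansion:
  "beta M M' \<Longrightarrow> weakly_normalising M' \<Longrightarrow> weakly_normalising M"
  unfolding weakly_normalising_def by (blast intro: converse_rtranclp_into_rtranclp)

text \<open>The right-hand side does not mention \<open>x\<close>: this is what permits exchanging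
  the head variable in \<open>L_arrow\<close>.\<close>

lemma weakly_normalising_apps_Var:
  "weakly_normalising (apps (Var x) Ns) \<longleftrightarrow> (\<forall>N\<in>set Ns. weakly_normalising N)"
  by (induction Ns rule: rev_induct)
    (auto simp: weakly_normalising_Var weakly_normalising_App_apps_Var)

theorem theorem5:
  fixes \<Gamma> :: "'a ctx" and M :: trm and A :: "'a ty"
  assumes "typing \<Gamma> M A"
  shows "weakly_normalising M"
  using assms
proof induction
  case Ax
  show ?case by (rule weakly_normalising_Var)
next
  case (Beta \<Gamma> N M Ns A)
  then show ?case
    by (blast intro: weakly_normalising_beta_expansion beta_apps_head beta.contract)
next
  case (L_arrow \<Gamma> N A1 y A2 Ns B x)
  \<comment> \<open>The hypothesis on the spine over \<open>y\<close> yields normalisation of every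
    term in \<open>Ns\<close>, the other one that of \<open>N\<close>; together they cover all
    arguments of \<open>x\<close>.\<close>
  then have "weakly_normalising (apps (Var x) (N # Ns))"
    by (simp only: weakly_normalising_apps_Var) simp
  then show ?case by simp
next
  case R_arrow
  then show ?case by (blast intro: weakly_normalising_Lam)
\<comment> \<open>In \<open>L_inter\<close> and \<open>R_inter\<close> the premises have the same
  subject as the conclusion, so the induction hypothesis is the goal.\<close>
qed

end
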